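(* Let $\mathbb{E}=\mathbb{R}$ or $\mathbb{E}=\mathbb{C}$, and let $\{f_k\}_{k=1}^N$ be a uniform frame for $\mathbb{E}^m$. Then $$\mathcal{M}(\{f_k\}_{k=1}^N)\;\ge\;\sqrt{\frac{N-m}{m(N-1)}}. \qquad ( * )$$ Equality holds in $( * )$ if and only if $\{f_k\}_{k=1}^N$ is an equiangular tight frame. Furthermore, if $\mathbb{E}=\mathbb{R}$, equality in $( * )$ can only hold if $N\le \frac{m(m+1)}{2}$; and if $\mathbb{E}=\mathbb{C}$, equality in $( * )$ can only hold if $N\le m^2$.
   Context: A frame $\{f_k\}_{k=1}^N$ for $\mathbb{E}^m$ is a finite sequence of vectors for which there exist constants $A,B>0$ with $A\|f\|^2\le\sum_{k=1}^N|\langle f,f_k\rangle|^2\le B\|f\|^2$ for all $f\in\mathbb{E}^m$ (equivalently, the $f_k$ span $\mathbb{E}^m$). It is tight if one can take $A=B$, and uniform if $\|f_k\|=1$ for all $k$. A uniform frame is equiangular if there is a constant $c\ge 0$ with $|\langle f_k,f_l\rangle|=c$ for all $k\ne l$. The maximal frame correlation of a uniform frame is $\mathcal{M}(\{f_k\}_{k=1}^N)=\max_{k\ne l}|\langle f_k,f_l\rangle|$.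
   Formalization: The bounds N ≤ m(m+1)/2 and N ≤ m² are stated for m ≥ 2, since for m = 1 any N ≥ 2 unit scalars give equality with N > 1; N ≥ 2 is assumed throughout so that the maximum and the bound are defined. *)

theory Defs
  imports "HOL-Analysis.Analysis"
begin

text \<open>
  The Hermitian inner product on complex Euclidean space, linear in the first argument.
  The library's \<open>inner\<close> on \<open>complex ^ 'm\<close> is only its real part; the library norm on
  \<open>complex ^ 'm\<close> is the norm it induces (see \<open>hermitian_self\<close>).
\<close>
definition hermitian :: "complex ^ 'm \<Rightarrow> complex ^ 'm \<Rightarrow> complex" where
  "hermitian x y = (\<Sum>i\<in>UNIV. x $ i * cnj (y $ i))"

lemma hermitian_self: "hermitian x x = of_real ((norm x)\<^sup>2)"
  unfolding hermitian_def norm_vec_def L2_set_def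
  by (simp add: sum_nonneg flip: complex_norm_square)

text \<open>
  The frame notions take the scalar product \<open>ip\<close> as a parameter, so that they serve both
  scalar fields: \<open>ip\<close> is \<open>inner\<close> on \<open>real ^ 'm\<close> and \<open>hermitian\<close> on \<open>complex ^ 'm\<close>.
  A finite sequence of length \<open>N\<close> is a function on \<open>nat\<close> of which only the values at
  \<open>1, \<dots>, N\<close> matter.
\<close>
definition frame_bounds ::
    "('v::real_normed_vector \<Rightarrow> 'v \<Rightarrow> 'e::real_normed_field) \<Rightarrow> real \<Rightarrow> real \<Rightarrow> nat \<Rightarrow> (nat \<Rightarrow> 'v) \<Rightarrow> bool"
  where
  "frame_bounds ip A B N f \<longleftrightarrow> A > 0 \<and> B > 0 \<and>
     (\<forall>x. A * (norm x)\<^sup>2 \<le> (\<Sum>k=1..N. (norm (ip x (f k)))\<^sup>2) \<and>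
          (\<Sum>k=1..N. (norm (ip x (f k)))\<^sup>2) \<le> B * (norm x)\<^sup>2)"

definition is_frame ::
    "('v::real_normed_vector \<Rightarrow> 'v \<Rightarrow> 'e::real_normed_field) \<Rightarrow> nat \<Rightarrow> (nat \<Rightarrow> 'v) \<Rightarrow> bool" where
  "is_frame ip N f \<longleftrightarrow> (\<exists>A B. frame_bounds ip A B N f)"

definition tight_frame ::
    "('v::real_normed_vector \<Rightarrow> 'v \<Rightarrow> 'e::real_normed_field) \<Rightarrow> nat \<Rightarrow> (nat \<Rightarrow> 'v) \<Rightarrow> bool" where
  "tight_frame ip N f \<longleftrightarrow> (\<exists>A. frame_bounds ip A A N f)"

definition uniform_frame ::
    "('v::real_normed_vector \<Rightarrow> 'v \<Rightarrow> 'e::real_normed_field) \<Rightarrow> nat \<Rightarrow> (nat \<Rightarrow> 'v) \<Rightarrow> bool" where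
  "uniform_frame ip N f \<longleftrightarrow> is_frame ip N f \<and> (\<forall>k\<in>{1..N}. norm (f k) = 1)"

definition equiangular_frame ::
    "('v::real_normed_vector \<Rightarrow> 'v \<Rightarrow> 'e::real_normed_field) \<Rightarrow> nat \<Rightarrow> (nat \<Rightarrow> 'v) \<Rightarrow> bool" where
  "equiangular_frame ip N f \<longleftrightarrow> uniform_frame ip N f \<and>
     (\<exists>c\<ge>0. \<forall>k\<in>{1..N}. \<forall>l\<in>{1..N}. k \<noteq> l \<longrightarrow> norm (ip (f k) (f l)) = c)"

text \<open>Meaningful only for \<open>N \<ge> 2\<close>; otherwise the maximum is over the empty set.\<close>
definition max_correlation ::
    "('v::real_normed_vector \<Rightarrow> 'v \<Rightarrow> 'e::real_normed_field) \<Rightarrow> nat \<Rightarrow> (nat \<Rightarrow> 'v) \<Rightarrow> real" where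
  "max_correlation ip N f =
     Max {norm (ip (f k) (f l)) | k l. k \<in> {1..N} \<and> l \<in> {1..N} \<and> k \<noteq> l}"

definition welch_bound :: "nat \<Rightarrow> nat \<Rightarrow> real" where
  "welch_bound m N = sqrt ((real N - real m) / (real m * (real N - 1)))"

end

theory Submission
  imports Defs
begin

text \<open>
  Send a vector to the rank one operator \<open>P x = x x\<^sup>*\<close>, a point of a real Euclidean space in
  which \<open>P x \<bullet> P y = |\<langle>x, y\<rangle>|\<^sup>2\<close>. Write \<open>I\<close> for the identity, \<open>S\<close> for the sum of the
  \<open>P (f k)\<close> (the frame operator), and \<open>w\<close> for the square of the Welch bound. Expanding the
  square gives, for every \<open>M\<close>,
  \<open>(\<Sum>k\<noteq>l. M\<^sup>2 - |\<langle>f k, f l\<rangle>|\<^sup>2) + \<parallel>S - (N/m) I\<parallel>\<^sup>2 = N (N - 1) (M\<^sup>2 - w)\<close>.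
  When \<open>M\<close> is the maximal correlation both terms on the left are nonnegative; the first vanishes
  exactly for equiangular frames and the second exactly for tight ones. Moreover, the \<open>P (f k)\<close>
  of an equiangular frame with correlation below 1 are linearly independent, so \<open>N\<close> is at most
  the dimension of the symmetric (respectively Hermitian) matrices.
\<close>

text \<open>The scalar product is abstracted so that one argument serves \<real> and \<complex>. The
  codomain of \<open>P\<close> is always a real Euclidean space, because the linear independence
  used later is over \<real>. The family \<open>e\<close> plays the role of an orthonormal basis, so
  \<open>CARD('i)\<close> is the dimension m.\<close>

locale rank_one_embedding =
  fixes ip :: "'v::real_normed_vector \<Rightarrow> 'v \<Rightarrow> 'e::real_normed_field"
    and P :: "'v \<Rightarrow> 'w::euclidean_space"
    and e :: "'i::finite \<Rightarrow> 'v"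
  assumes inner_P: "inner (P x) (P y) = (norm (ip x y))\<^sup>2"
    and norm_ip_self: "norm (ip x x) = (norm x)\<^sup>2"
    and parseval: "(\<Sum>i\<in>UNIV. (norm (ip x (e i)))\<^sup>2) = (norm x)\<^sup>2"
    and norm_e: "norm (e i) = 1"
begin

text \<open>The resolution of the identity over the basis. Pairing with it plays the role of the
  trace.\<close>

definition identity :: 'w where
  "identity = (\<Sum>i\<in>UNIV. P (e i))"

definition frame_op :: "nat \<Rightarrow> (nat \<Rightarrow> 'v) \<Rightarrow> 'w" where
  "frame_op N f = (\<Sum>k=1..N. P (f k))"

lemma inner_P_identity: "inner (P x) identity = (norm x)\<^sup>2"
  by (simp add: identity_def inner_sum_right inner_P parseval)

lemma inner_identity_identity: "inner identity identity = real CARD('i)"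
proof -
  have "inner identity identity = (\<Sum>i\<in>UNIV. inner (P (e i)) identity)"
    by (subst identity_def) (rule inner_sum_left)
  then show ?thesis by (simp add: inner_P_identity norm_e)
qed

lemma inner_P_frame_op: "inner (P x) (frame_op N f) = (\<Sum>k=1..N. (norm (ip x (f k)))\<^sup>2)"
  by (simp add: frame_op_def inner_sum_right inner_P)

lemma inner_frame_op_identity:
  assumes "\<forall>k\<in>{1..N}. norm (f k) = 1"
  shows "inner (frame_op N f) identity = real N"
  using assms by (simp add: frame_op_def inner_sum_left inner_P_identity)

lemma inner_frame_op_frame_op:
  assumes "\<forall>k\<in>{1..N}. norm (f k) = 1"
  shows "inner (frame_op N f) (frame_op N f) =
    real N + (\<Sum>k=1..N. \<Sum>l\<in>{1..N}-{k}. (norm (ip (f k) (f l)))\<^sup>2)"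
proof -
  have "inner (frame_op N f) (frame_op N f) = (\<Sum>k=1..N. \<Sum>l=1..N. (norm (ip (f k) (f l)))\<^sup>2)"
    by (subst frame_op_def) (simp add: inner_sum_left inner_P_frame_op)
  also have "\<dots> = (\<Sum>k=1..N. 1 + (\<Sum>l\<in>{1..N}-{k}. (norm (ip (f k) (f l)))\<^sup>2))"
  proof (rule sum.cong[OF refl])
    fix k assume k: "k \<in> {1..N}"
    then have "norm (f k) = 1" using assms by blast
    then show "(\<Sum>l=1..N. (norm (ip (f k) (f l)))\<^sup>2) = 1 + (\<Sum>l\<in>{1..N}-{k}. (norm (ip (f k) (f l)))\<^sup>2)"
      using sum.remove[OF _ k, of "\<lambda>l. (norm (ip (f k) (f l)))\<^sup>2"] by (simp add: norm_ip_self)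
  qed
  finally show ?thesis by (simp add: sum.distrib)
qed

lemma welch_defect:
  assumes N: "N \<ge> 2" and unit: "\<forall>k\<in>{1..N}. norm (f k) = 1"
  shows "(\<Sum>k=1..N. \<Sum>l\<in>{1..N}-{k}. t - (norm (ip (f k) (f l)))\<^sup>2)
      + (norm (frame_op N f - (real N / real CARD('i)) *\<^sub>R identity))\<^sup>2
    = real N * (real N - 1) *
      (t - (real N - real CARD('i)) / (real CARD('i) * (real N - 1)))" (is "?D + ?T = _")
proof -
  let ?m = "real CARD('i)"
  let ?X = "\<Sum>k=1..N. \<Sum>l\<in>{1..N}-{k}. (norm (ip (f k) (f l)))\<^sup>2"
  have m: "?m > 0" by simp
  have "(\<Sum>k=1..N. \<Sum>l\<in>{1..N}-{k}. t) = (\<Sum>k=1..N. (real N - 1) * t)"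
    using N by (intro sum.cong) (auto simp: card_Diff_singleton of_nat_diff)
  then have D: "?D = real N * (real N - 1) * t - ?X"
    by (simp add: sum_subtractf)
  have "?T = inner (frame_op N f) (frame_op N f)
      - 2 * (real N / ?m) * inner (frame_op N f) identity
      + (real N / ?m)\<^sup>2 * inner identity identity"
    unfolding power2_norm_eq_inner
    by (simp add: inner_diff_left inner_diff_right inner_commute power2_eq_square algebra_simps)
  \<comment> \<open>N/m is the coefficient of the orthogonal projection of the frame operator onto
    \<open>identity\<close>, since their pairing is N and \<open>identity\<close> has squared norm
    m. By Pythagoras the projection removes exactly N^2/m.\<close>
  then have T: "?T = real N + ?X - (real N)\<^sup>2 / ?m"
    using m by (simp add: inner_frame_op_frame_op[OF unit] inner_frame_op_identity[OF unit]
        inner_identity_identity power2_eq_square)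
  have "real N - 1 > 0" using N by simp
  then show ?thesis unfolding D T using m by (simp add: field_simps power2_eq_square)
qed

section \<open>Tightness as proportionality of the frame operator to the identity\<close>

lemma frame_op_eq_if_tight:
  assumes tight: "tight_frame ip N f" and unit: "\<forall>k\<in>{1..N}. norm (f k) = 1"
  shows "frame_op N f = (real N / real CARD('i)) *\<^sub>R identity"
proof -
  obtain A where "frame_bounds ip A A N f"
    using tight by (auto simp: tight_frame_def)
  then have A: "(\<Sum>k=1..N. (norm (ip x (f k)))\<^sup>2) = A * (norm x)\<^sup>2" for x
    unfolding frame_bounds_def by (meson order_antisym)
  let ?d = "frame_op N f - A *\<^sub>R identity"
  have orth: "inner (P x) ?d = 0" for x
    by (simp only: inner_diff_right inner_P_frame_op A inner_P_identity inner_scaleR_right diff_self)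
  \<comment> \<open>\<open>?d\<close> is orthogonal to the range of \<open>P\<close> and itself a combination of values of \<open>P\<close>.\<close>
  have "inner (frame_op N f) ?d = 0" "inner identity ?d = 0"
    by (subst frame_op_def identity_def, simp only: inner_sum_left orth sum.neutral_const)+
  then have "inner ?d ?d = 0"
    by (simp only: inner_diff_left inner_scaleR_left mult_zero_right diff_self)
  then have S: "frame_op N f = A *\<^sub>R identity" by simp
  \<comment> \<open>Taking traces fixes the frame constant at N/m.\<close>
  have "real N = A * real CARD('i)"
    using inner_frame_op_identity[OF unit] by (simp add: S inner_identity_identity)
  then show ?thesis by (simp add: S)
qed

lemma tight_if_frame_op_eq:
  assumes "frame_op N f = A *\<^sub>R identity" "A > 0"
  shows "tight_frame ip N f"
proof -
  have "(\<Sum>k=1..N. (norm (ip x (f k)))\<^sup>2) = A * (norm x)\<^sup>2" for x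
    by (simp only: assms(1) inner_P_identity inner_scaleR_right flip: inner_P_frame_op)
  then show ?thesis
    using assms(2) by (auto simp: tight_frame_def frame_bounds_def)
qed

section \<open>The maximal correlation, the Welch inequality and its equality case\<close>

lemma finite_correlations:
  "finite {norm (ip (f k) (f l)) | k l. k \<in> {1..N::nat} \<and> l \<in> {1..N} \<and> k \<noteq> l}"
  by (rule finite_subset[of _ "(\<lambda>(k, l). norm (ip (f k) (f l))) ` ({1..N} \<times> {1..N})"]) auto

lemma correlation_le_max:
  assumes "k \<in> {1..N}" "l \<in> {1..N}" "k \<noteq> l"
  shows "norm (ip (f k) (f l)) \<le> max_correlation ip N f"
  unfolding max_correlation_def using assms by (intro Max_ge finite_correlations) auto

lemma max_correlation_nonneg:
  assumes "N \<ge> 2"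
  shows "max_correlation ip N f \<ge> 0"
  using correlation_le_max[of 1 N 2 f] assms by (force intro: order_trans[OF norm_ge_zero])

lemma max_correlation_constant:
  assumes "N \<ge> 2"
    and "\<And>k l. k \<in> {1..N} \<Longrightarrow> l \<in> {1..N} \<Longrightarrow> k \<noteq> l \<Longrightarrow> norm (ip (f k) (f l)) = c"
  shows "max_correlation ip N f = c"
proof -
  have "1 \<in> {1..N}" "2 \<in> {1..N}" "(1::nat) \<noteq> 2" using assms(1) by auto
  then have "{norm (ip (f k) (f l)) | k l. k \<in> {1..N} \<and> l \<in> {1..N} \<and> k \<noteq> l} = {c}"
    using assms(2) by blast
  then show ?thesis by (simp add: max_correlation_def)
qed

lemma
  assumes N: "N \<ge> 2" and uf: "uniform_frame ip N f"
  shows welch_inequality: "max_correlation ip N f \<ge> welch_bound CARD('i) N"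
    and welch_equality_iff: "max_correlation ip N f = welch_bound CARD('i) N \<longleftrightarrow>
      equiangular_frame ip N f \<and> tight_frame ip N f"
proof -
  let ?M = "max_correlation ip N f"
  let ?w = "(real N - real CARD('i)) / (real CARD('i) * (real N - 1))"
  let ?D = "\<Sum>k=1..N. \<Sum>l\<in>{1..N}-{k}. ?M\<^sup>2 - (norm (ip (f k) (f l)))\<^sup>2"
  let ?T = "(norm (frame_op N f - (real N / real CARD('i)) *\<^sub>R identity))\<^sup>2"
  have unit: "\<forall>k\<in>{1..N}. norm (f k) = 1" using uf by (simp add: uniform_frame_def)
  have M0: "?M \<ge> 0" by (rule max_correlation_nonneg[OF N])
  have N0: "real N * (real N - 1) > 0" using N by simp
  have defect: "?D + ?T = real N * (real N - 1) * (?M\<^sup>2 - ?w)"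
    by (rule welch_defect[OF N unit])
  have term0: "?M\<^sup>2 - (norm (ip (f k) (f l)))\<^sup>2 \<ge> 0" if "k \<in> {1..N}" "l \<in> {1..N}-{k}" for k l
    using correlation_le_max[of k N l f] that by (simp add: power_mono)
  have inner0: "(\<Sum>l\<in>{1..N}-{k}. ?M\<^sup>2 - (norm (ip (f k) (f l)))\<^sup>2) \<ge> 0" if "k \<in> {1..N}" for k
    using that by (intro sum_nonneg term0)
  have D0: "?D \<ge> 0" by (intro sum_nonneg[OF inner0])
  have "0 \<le> real N * (real N - 1) * (?M\<^sup>2 - ?w)"
    unfolding defect[symmetric] using D0 by simp
  then have "?w \<le> ?M\<^sup>2" using N0 by (simp add: zero_le_mult_iff)
  \<comment> \<open>\<open>sqrt\<close> is an odd, strictly increasing function on all reals, so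
    this step and the equivalence with \<open>?M\<^sup>2 = ?w\<close> below hold whatever the sign
    of \<open>?w\<close>.\<close>
  then have "sqrt ?w \<le> sqrt (?M\<^sup>2)" by (rule real_sqrt_le_mono)
  then show "?M \<ge> welch_bound CARD('i) N"
    using M0 by (simp add: welch_bound_def)
  have "?M = welch_bound CARD('i) N \<longleftrightarrow> sqrt (?M\<^sup>2) = sqrt ?w"
    using M0 by (simp add: welch_bound_def)
  also have "\<dots> \<longleftrightarrow> ?M\<^sup>2 = ?w" by (rule real_sqrt_eq_iff)
  also have "\<dots> \<longleftrightarrow> ?D + ?T = 0" unfolding defect using N0 by auto
  also have "\<dots> \<longleftrightarrow> ?D = 0 \<and> ?T = 0" using D0 by (simp add: add_nonneg_eq_0_iff)
  also have "\<dots> \<longleftrightarrow> equiangular_frame ip N f \<and> tight_frame ip N f"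
  proof (intro arg_cong2[of _ _ _ _ "(\<and>)"])
    have "?D = 0 \<longleftrightarrow> (\<forall>k\<in>{1..N}. \<forall>l\<in>{1..N}-{k}. ?M\<^sup>2 - (norm (ip (f k) (f l)))\<^sup>2 = 0)"
    proof -
      have "?D = 0 \<longleftrightarrow>
          (\<forall>k\<in>{1..N}. (\<Sum>l\<in>{1..N}-{k}. ?M\<^sup>2 - (norm (ip (f k) (f l)))\<^sup>2) = 0)"
        by (rule sum_nonneg_eq_0_iff[OF finite_atLeastAtMost inner0])
      also have "\<dots> \<longleftrightarrow> (\<forall>k\<in>{1..N}. \<forall>l\<in>{1..N}-{k}. ?M\<^sup>2 - (norm (ip (f k) (f l)))\<^sup>2 = 0)"
        by (intro ball_cong refl sum_nonneg_eq_0_iff term0) auto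
      finally show ?thesis .
    qed
    also have "\<dots> \<longleftrightarrow> (\<forall>k\<in>{1..N}. \<forall>l\<in>{1..N}. k \<noteq> l \<longrightarrow> norm (ip (f k) (f l)) = ?M)"
    proof -
      have off_diagonal: "(\<forall>l\<in>A-{k}. Q l) \<longleftrightarrow> (\<forall>l\<in>A. k \<noteq> l \<longrightarrow> Q l)"
        for A and k :: nat and Q by auto
      have "?M\<^sup>2 - (norm (ip (f k) (f l)))\<^sup>2 = 0 \<longleftrightarrow> norm (ip (f k) (f l)) = ?M" for k l
        using M0 by (auto simp: power2_eq_iff_nonneg)
      then show ?thesis by (simp only: off_diagonal)
    qed
    also have "\<dots> \<longleftrightarrow> equiangular_frame ip N f"
    proof
      assume "equiangular_frame ip N f"
      then obtain c where c: "\<And>k l. k \<in> {1..N} \<Longrightarrow> l \<in> {1..N} \<Longrightarrow> k \<noteq> l \<Longrightarrow> norm (ip (f k) (f l)) = c"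
        unfolding equiangular_frame_def by blast
      show "\<forall>k\<in>{1..N}. \<forall>l\<in>{1..N}. k \<noteq> l \<longrightarrow> norm (ip (f k) (f l)) = ?M"
        using c max_correlation_constant[OF N, of f, OF c] by blast
    next
      assume "\<forall>k\<in>{1..N}. \<forall>l\<in>{1..N}. k \<noteq> l \<longrightarrow> norm (ip (f k) (f l)) = ?M"
      then show "equiangular_frame ip N f"
        unfolding equiangular_frame_def using uf M0 by blast
    qed
    finally show "?D = 0 \<longleftrightarrow> equiangular_frame ip N f" .
    show "?T = 0 \<longleftrightarrow> tight_frame ip N f"
      using frame_op_eq_if_tight[OF _ unit] tight_if_frame_op_eq[of N f "real N / real CARD('i)"] N
      by auto
  qed
  finally show "?M = welch_bound CARD('i) N \<longleftrightarrow>
      equiangular_frame ip N f \<and> tight_frame ip N f" .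
qed

text \<open>The Gram matrix of the \<open>P (f k)\<close> is (1 - c^2) I + c^2 J with J the all-ones
  matrix, which is positive definite for c < 1. Injectivity ensures that the image really has N
  elements.\<close>

lemma equiangular_independent:
  fixes f :: "nat \<Rightarrow> 'v"
  assumes unit: "\<forall>k\<in>{1..N}. norm (f k) = 1"
    and c: "0 \<le> c" "c < 1"
    and eq: "\<And>k l. k \<in> {1..N} \<Longrightarrow> l \<in> {1..N} \<Longrightarrow> k \<noteq> l \<Longrightarrow> norm (ip (f k) (f l)) = c"
  shows "inj_on (\<lambda>k. P (f k)) {1..N}" and "independent ((\<lambda>k. P (f k)) ` {1..N})"
proof -
  have c2: "c\<^sup>2 < 1" using c by (simp add: power_less_one_iff)
  have gram: "inner (P (f k)) (P (f l)) = (if k = l then 1 else c\<^sup>2)"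
    if "k \<in> {1..N}" "l \<in> {1..N}" for k l
    using eq[OF that] unit that by (auto simp: inner_P norm_ip_self)
  show inj: "inj_on (\<lambda>k. P (f k)) {1..N}"
  proof (rule inj_onI)
    fix k l assume kl: "k \<in> {1..N}" "l \<in> {1..N}" "P (f k) = P (f l)"
    then show "k = l" using gram[of k l] gram[of k k] c2 by (auto split: if_splits)
  qed
  have zero: "a k = 0" if k: "k \<in> {1..N}" and a: "(\<Sum>k=1..N. a k *\<^sub>R P (f k)) = 0"
    for a :: "nat \<Rightarrow> real" and k
  proof -
    let ?s = "\<Sum>k=1..N. a k"
    have row: "(1 - c\<^sup>2) * a l + c\<^sup>2 * ?s = 0" if l: "l \<in> {1..N}" for l
    proof -
      have "0 = (\<Sum>k=1..N. a k * inner (P (f k)) (P (f l)))"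
        using arg_cong[OF a, of "\<lambda>v. inner v (P (f l))"] by (simp add: inner_sum_left)
      also have "\<dots> = (\<Sum>k=1..N. (if k = l then (1 - c\<^sup>2) * a k else 0) + c\<^sup>2 * a k)"
        by (intro sum.cong refl, subst gram[OF _ l]) (auto simp: algebra_simps)
      also have "\<dots> = (1 - c\<^sup>2) * a l + c\<^sup>2 * ?s"
        using l by (simp add: sum.distrib sum_distrib_left)
      finally show ?thesis by simp
    qed
    \<comment> \<open>Adding all rows isolates the coefficient sum \<open>?s\<close>, multiplied by
      the eigenvalue of the Gram matrix at the all-ones vector. Once \<open>?s\<close> vanishes,
      each single row gives its own coefficient.\<close>
    have "(\<Sum>l=1..N. (1 - c\<^sup>2) * a l + c\<^sup>2 * ?s) = (\<Sum>l=1..N. 0)"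
      by (intro sum.cong refl row)
    then have "((1 - c\<^sup>2) + real N * c\<^sup>2) * ?s = 0"
      by (simp add: sum.distrib distrib_right flip: sum_distrib_left)
    moreover have "(1 - c\<^sup>2) + real N * c\<^sup>2 > 0" using c2 by (simp add: add_pos_nonneg)
    ultimately have "?s = 0" by simp
    then show ?thesis using row[OF k] c2 by simp
  qed
  show "independent ((\<lambda>k. P (f k)) ` {1..N})"
  proof (subst independent_explicit, intro conjI allI impI ballI)
    fix u v
    assume u: "(\<Sum>v\<in>(\<lambda>k. P (f k)) ` {1..N}. u v *\<^sub>R v) = 0" and v: "v \<in> (\<lambda>k. P (f k)) ` {1..N}"
    have "(\<Sum>k=1..N. u (P (f k)) *\<^sub>R P (f k)) = 0"
      using u unfolding sum.reindex[OF inj] o_def .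
    then show "u v = 0" using zero[of _ "\<lambda>k. u (P (f k))"] v by blast
  qed simp
qed

lemma welch_equality_card_le_dim:
  assumes N: "N \<ge> 2" and uf: "uniform_frame ip N f" and m: "CARD('i) \<ge> 2"
    and eq: "max_correlation ip N f = welch_bound CARD('i) N"
  shows "N \<le> dim (range P)"
proof -
  let ?m = "real CARD('i)" and ?M = "max_correlation ip N f"
  have unit: "\<forall>k\<in>{1..N}. norm (f k) = 1" using uf by (simp add: uniform_frame_def)
  obtain c where c: "c \<ge> 0" "\<And>k l. k \<in> {1..N} \<Longrightarrow> l \<in> {1..N} \<Longrightarrow> k \<noteq> l \<Longrightarrow> norm (ip (f k) (f l)) = c"
    using eq welch_equality_iff[OF N uf] unfolding equiangular_frame_def by blast
  have "c = sqrt ((real N - ?m) / (?m * (real N - 1)))"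
    using max_correlation_constant[OF N c(2)] eq by (simp add: welch_bound_def)
  \<comment> \<open>This puts the Welch bound below 1. It amounts to N < m N, which is where m \<ge>
    2 enters.\<close>
  moreover have "real N - ?m < ?m * (real N - 1)"
  proof -
    have "1 * real N < ?m * real N" using m N by (intro mult_strict_right_mono) auto
    then show ?thesis by (simp add: algebra_simps)
  qed
  moreover have "?m * (real N - 1) > 0" using N by simp
  ultimately have "c < 1" by simp
  note ind = equiangular_independent[OF unit c(1) this c(2)]
  have "N = card ((\<lambda>k. P (f k)) ` {1..N})" using card_image[OF ind(1)] by simp
  also have "\<dots> \<le> dim (range P)"
    by (rule independent_card_le_dim[OF _ ind(2)]) auto
  finally show ?thesis .
qed

end

section \<open>The real case: symmetric matrices\<close>

definition real_rank_one :: "real ^ 'm \<Rightarrow> real ^ 'm ^ 'm" where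
  "real_rank_one x = (\<chi> i j. x $ i * x $ j)"

lemma norm_axis_one: "norm (axis i (1::'a::{real_normed_field}) :: 'a ^ 'm) = 1"
proof -
  have "(\<Sum>j\<in>UNIV. (norm (axis i (1::'a) $ j :: 'a))\<^sup>2) = (\<Sum>j\<in>(UNIV::'m set). if j = i then 1 else 0)"
    by (intro sum.cong) (auto simp: axis_def)
  then show ?thesis by (simp add: norm_vec_def L2_set_def)
qed

lemma norm_vec_power2: "(norm (x :: 'a::real_normed_vector ^ 'm))\<^sup>2 = (\<Sum>i\<in>UNIV. (norm (x $ i))\<^sup>2)"
  by (simp add: norm_vec_def L2_set_def sum_nonneg)

interpretation real_embedding:
  rank_one_embedding inner real_rank_one "\<lambda>i. axis i 1 :: real ^ 'm"
proof
  fix x y :: "real ^ 'm" and i :: 'm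
  show "inner (real_rank_one x) (real_rank_one y) = (norm (inner x y))\<^sup>2"
    by (simp add: real_rank_one_def inner_vec_def power2_eq_square sum_product mult_ac)
  show "norm (inner x x) = (norm x)\<^sup>2"
    by (simp add: power2_norm_eq_inner)
  show "(\<Sum>i\<in>UNIV. (norm (inner x (axis i 1)))\<^sup>2) = (norm x)\<^sup>2"
    by (simp add: inner_axis norm_vec_power2)
qed (rule norm_axis_one)

lemma dim_range_real_rank_one:
  "real (dim (range (real_rank_one :: real ^ 'm \<Rightarrow> _))) \<le> real CARD('m) * (real CARD('m) + 1) / 2"
proof -
  \<comment> \<open>The standard basis of the symmetric matrices, indexed by unordered pairs:
    singletons give the diagonal units, two-element sets the symmetrized off-diagonal ones.\<close>
  define B :: "'m set \<Rightarrow> real ^ 'm ^ 'm" where "B X = (\<chi> i j. if {i, j} = X then 1 else 0)" for X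
  define \<S> :: "'m set set" where "\<S> = {X. card X = 1} \<union> {X. card X = 2}"
  have "real_rank_one x \<in> span (B ` \<S>)" for x
  proof -
    \<comment> \<open>The entry of \<open>real_rank_one x\<close> at an unordered position; it is
      well defined because the product is symmetric in i and j.\<close>
    define g where "g X = (THE r. \<forall>i j. {i, j} = X \<longrightarrow> r = x $ i * x $ j)" for X :: "'m set"
    have g: "g {i, j} = x $ i * x $ j" for i j
      unfolding g_def by (rule the_equality) (auto simp: doubleton_eq_iff)
    have mem: "{i, j} \<in> \<S>" for i j
      by (cases "i = j") (auto simp: \<S>_def)
    have "real_rank_one x = (\<Sum>X\<in>\<S>. g X *\<^sub>R B X)"
      by (simp add: vec_eq_iff real_rank_one_def B_def mem g if_distrib[of "\<lambda>z. _ * z"] cong: if_cong)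
    then show ?thesis by (simp only:) (intro span_sum span_scale span_base imageI)
  qed
  then have "dim (range (real_rank_one :: real ^ 'm \<Rightarrow> _)) \<le> card (B ` \<S>)"
    by (intro dim_le_card) auto
  also have "\<dots> \<le> card \<S>" by (rule card_image_le) simp
  also have "\<dots> = (CARD('m) choose 1) + (CARD('m) choose 2)"
    unfolding \<S>_def using n_subsets[of "UNIV :: 'm set"]
    by (subst card_Un_disjoint) auto
  finally have "real (dim (range (real_rank_one :: real ^ 'm \<Rightarrow> _)))
      \<le> real (CARD('m) + CARD('m) * (CARD('m) - 1) div 2)"
    by (simp only: of_nat_le_iff choose_two choose_one)
  also have "\<dots> = real CARD('m) * (real CARD('m) + 1) / 2"
  proof -
    \<comment> \<open>Parity makes the natural number division by 2 exact.\<close>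
    have "even (CARD('m) * (CARD('m) - 1))" by (cases "CARD('m)") auto
    then show ?thesis by (simp add: real_of_nat_div of_nat_diff field_simps)
  qed
  finally show ?thesis .
qed

section \<open>The complex case: Hermitian matrices\<close>

text \<open>
  Adding the (symmetric) real part and the (antisymmetric) imaginary part of a Hermitian matrix
  is an isometry from the Hermitian matrices onto all real matrices, which makes the dimension
  bound \<open>m\<^sup>2\<close> immediate.
\<close>
definition complex_rank_one :: "complex ^ 'm \<Rightarrow> real ^ 'm ^ 'm" where
  "complex_rank_one x = (\<chi> i j. Re (x $ i * cnj (x $ j)) + Im (x $ i * cnj (x $ j)))"

lemma inner_complex_rank_one:
  "inner (complex_rank_one x) (complex_rank_one y) = (norm (hermitian x y))\<^sup>2"
proof -
  define a where "a i j = x $ i * cnj (x $ j)" for i j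
  define b where "b i j = y $ i * cnj (y $ j)" for i j
  \<comment> \<open>Exchanging i and j conjugates both \<open>a\<close> and \<open>b\<close>, hence
    negates every mixed product of a real and an imaginary part.\<close>
  have cross: "(\<Sum>i\<in>UNIV. \<Sum>j\<in>UNIV. Re (a i j) * Im (b i j) + Im (a i j) * Re (b i j)) = 0" (is "?c = 0")
  proof -
    have "?c = (\<Sum>i\<in>UNIV. \<Sum>j\<in>UNIV. Re (a j i) * Im (b j i) + Im (a j i) * Re (b j i))"
      by (rule sum.swap)
    also have "\<dots> = (\<Sum>i\<in>UNIV. \<Sum>j\<in>UNIV. - (Re (a i j) * Im (b i j) + Im (a i j) * Re (b i j)))"
      by (intro sum.cong refl) (simp add: a_def b_def algebra_simps)
    also have "\<dots> = - ?c" by (simp only: sum_negf)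
    finally show ?thesis by simp
  qed
  have "complex_of_real ((norm (hermitian x y))\<^sup>2) = hermitian x y * cnj (hermitian x y)"
    by (rule complex_norm_square)
  also have "\<dots> = (\<Sum>i\<in>UNIV. \<Sum>j\<in>UNIV. a i j * cnj (b i j))"
    by (simp add: hermitian_def a_def b_def sum_product mult_ac)
  finally have "(norm (hermitian x y))\<^sup>2 = Re (\<Sum>i\<in>UNIV. \<Sum>j\<in>UNIV. a i j * cnj (b i j))"
    by (metis Re_complex_of_real)
  also have "\<dots> = (\<Sum>i\<in>UNIV. \<Sum>j\<in>UNIV. Re (a i j) * Re (b i j) + Im (a i j) * Im (b i j))"
    by simp
  \<comment> \<open>The vanishing mixed terms are added so that each summand factors into the
    entries of the two real matrices.\<close>
  also have "\<dots> = (\<Sum>i\<in>UNIV. \<Sum>j\<in>UNIV. Re (a i j) * Re (b i j) + Im (a i j) * Im (b i j)) + ?c"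
    by (simp only: cross)
  also have "\<dots> = (\<Sum>i\<in>UNIV. \<Sum>j\<in>UNIV. (Re (a i j) + Im (a i j)) * (Re (b i j) + Im (b i j)))"
    unfolding sum.distrib[symmetric] by (intro sum.cong refl) (simp only: algebra_simps)
  also have "\<dots> = inner (complex_rank_one x) (complex_rank_one y)"
    by (simp add: complex_rank_one_def inner_vec_def a_def b_def)
  finally show ?thesis by simp
qed

interpretation complex_embedding:
  rank_one_embedding hermitian complex_rank_one "\<lambda>i. axis i 1 :: complex ^ 'm"
proof
  fix x y :: "complex ^ 'm" and i :: 'm
  show "inner (complex_rank_one x) (complex_rank_one y) = (norm (hermitian x y))\<^sup>2"
    by (rule inner_complex_rank_one)
  show "norm (hermitian x x) = (norm x)\<^sup>2"
    unfolding hermitian_self by (simp only: norm_of_real) simp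
  have "hermitian x (axis i 1) = x $ i" for i
    by (simp add: hermitian_def axis_def if_distrib[of cnj] if_distrib[of "\<lambda>z. _ * z"] cong: if_cong)
  then show "(\<Sum>i\<in>UNIV. (norm (hermitian x (axis i 1)))\<^sup>2) = (norm x)\<^sup>2"
    by (simp add: norm_vec_power2)
qed (rule norm_axis_one)

lemma dim_range_complex_rank_one:
  "dim (range (complex_rank_one :: complex ^ 'm \<Rightarrow> _)) \<le> CARD('m)\<^sup>2"
  using dim_subset_UNIV[of "range (complex_rank_one :: complex ^ 'm \<Rightarrow> _)"]
  by (simp add: power2_eq_square)

text \<open>With N \<ge> 2 the maximum ranges over a nonempty set and N - 1 is not 0. The
  cardinality bounds are restricted to m \<ge> 2: for m = 1 the Welch bound is 1, and unit vectors
  attain it for every N \<ge> 2, while both bounds would give N \<le> 1.\<close>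

theorem theorem2p3:
  fixes N :: nat
  assumes "N \<ge> 2"
  shows
    "(\<forall>f :: nat \<Rightarrow> real ^ 'm. uniform_frame inner N f \<longrightarrow>
       max_correlation inner N f \<ge> welch_bound CARD('m) N \<and>
       (max_correlation inner N f = welch_bound CARD('m) N \<longleftrightarrow>
          equiangular_frame inner N f \<and> tight_frame inner N f) \<and>
       (CARD('m) \<ge> 2 \<longrightarrow> max_correlation inner N f = welch_bound CARD('m) N \<longrightarrow>
          real N \<le> real CARD('m) * (real CARD('m) + 1) / 2)) \<and>
     (\<forall>f :: nat \<Rightarrow> complex ^ 'm. uniform_frame hermitian N f \<longrightarrow>
       max_correlation hermitian N f \<ge> welch_bound CARD('m) N \<and>
       (max_correlation hermitian N f = welch_bound CARD('m) N \<longleftrightarrow>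
          equiangular_frame hermitian N f \<and> tight_frame hermitian N f) \<and>
       (CARD('m) \<ge> 2 \<longrightarrow> max_correlation hermitian N f = welch_bound CARD('m) N \<longrightarrow>
          N \<le> CARD('m) ^ 2))"
proof (intro conjI allI impI)
  fix f :: "nat \<Rightarrow> real ^ 'm"
  assume uf: "uniform_frame inner N f"
  show "max_correlation inner N f \<ge> welch_bound CARD('m) N"
    by (rule real_embedding.welch_inequality[OF assms uf])
  show "max_correlation inner N f = welch_bound CARD('m) N \<longleftrightarrow>
      equiangular_frame inner N f \<and> tight_frame inner N f"
    by (rule real_embedding.welch_equality_iff[OF assms uf])
  assume "CARD('m) \<ge> 2" "max_correlation inner N f = welch_bound CARD('m) N"
  then have "N \<le> dim (range (real_rank_one :: real ^ 'm \<Rightarrow> _))"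
    by (rule real_embedding.welch_equality_card_le_dim[OF assms uf])
  then show "real N \<le> real CARD('m) * (real CARD('m) + 1) / 2"
    using dim_range_real_rank_one[where 'm = 'm] by linarith
next
  fix f :: "nat \<Rightarrow> complex ^ 'm"
  assume uf: "uniform_frame hermitian N f"
  show "max_correlation hermitian N f \<ge> welch_bound CARD('m) N"
    by (rule complex_embedding.welch_inequality[OF assms uf])
  show "max_correlation hermitian N f = welch_bound CARD('m) N \<longleftrightarrow>
      equiangular_frame hermitian N f \<and> tight_frame hermitian N f"
    by (rule complex_embedding.welch_equality_iff[OF assms uf])
  assume "CARD('m) \<ge> 2" "max_correlation hermitian N f = welch_bound CARD('m) N"
  then have "N \<le> dim (range (complex_rank_one :: complex ^ 'm \<Rightarrow> _))"
    by (rule complex_embedding.welch_equality_card_le_dim[OF assms uf])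
  then show "N \<le> CARD('m) ^ 2"
    using dim_range_complex_rank_one[where 'm = 'm] by linarith
qed

end
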